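(* Let $m,p$ be positive integers, $m=k2^z$ with $k$ odd, and suppose that $r=0$, so that $N=\lceil z/p\rceil$. Let $C_\alpha$ and $D_{(j,X)}$ be the classes defined in the context (with $r=0$). \begin{itemize} \item We have $C_0=\{(0,T)\}$. \item For each integer $\alpha$ with $1\le\alpha\le N-1$, we have \[C_\alpha=\bigcup_{\beta=(\alpha-1)p}^{\alpha p-1}\{(k2^{z-\beta-1}+\ell k2^{z-\beta},B_\ell)\colon \ell\in\{0,\ldots,2^\beta-1\}\}.\] \item We have \[C_N=\bigcup_{\beta=(\lceil z/p\rceil-1)p}^{z-1}\{(k2^{z-\beta-1}+\ell k2^{z-\beta},B_\ell)\colon \ell\in\{0,\ldots,2^\beta-1\}\}.\] \item For $(j,X)\in(\{0,\ldots,k-1\}\times\{T,B\})\setminus\{(0,T)\}$, we have \[D_{(j,X)}=\{(j+\ell k,X_\ell)\colon\ell\in\{0,\ldots,2^z-1\}\}.\] \end{itemize}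
   Context: $\mathcal{T}$ is the set of $n\in\mathbb{N}$ whose binary expansion has an even number of digits $1$. Let $T,B$ be two symbols with $\overline{T}=B$, $\overline{B}=T$. For $X\in\{T,B\}$ and $n\in\mathbb{N}$, $X_n=X$ if $n\in\mathcal{T}$ and $X_n=\overline{X}$ otherwise. For general $r\in\{0,\ldots,m-1\}$, let $R$ be the length of the base-$2^p$ expansion of $r$ without leading zeroes (the expansion of $0$ is the empty word, so $R=0$ if $r=0$), and $N=\max\{\lceil z/p\rceil,R\}$. The following are subsets of $\{0,\ldots,m-1\}\times\{T,B\}$. For $\alpha\in\{0,\ldots,N\}$ let \[C_\alpha'=\begin{cases}\{(\lfloor\frac{r}{2^{p\alpha}}\rfloor+\ell\frac{m}{2^{p\alpha}},T_\ell)\colon 0\le\ell\le2^{p\alpha}-1\}&\text{if }\alpha\le\frac zp,\\ \{(\lfloor\frac{r}{2^{p\alpha}}\rfloor+\ell k,T_\ell)\colon 0\le\ell\le2^{z}-1\}&\text{if }\alpha\ge\frac zp,\end{cases}\qquad C_\alpha=C_\alpha'\setminus\bigcup_{\beta=0}^{\alpha-1}C_\beta'.\] For $(j,X)\in(\{0,\ldots,k-1\}\times\{T,B\})\setminus\{(0,T)\}$ let \[D_{(j,X)}'=\{(j+\ell k,X_\ell)\colon 0\le\ell\le 2^z-1\},\qquad D_{(j,X)}=D_{(j,X)}'\setminus\bigcup_{\alpha=0}^{N}C_\alpha.\]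
   Formalization: The formula for C_N is stated only for N ≥ 1 (equivalently z ≥ 1); for z = 0 one has N = 0 and C_N = C_0 = {(0,T)}, whereas the displayed union would be empty, contradicting the first item. *)

theory Defs
  imports Complex_Main "HOL-Library.Log_Nat"
begin

definition evil :: "nat set" where
  "evil = {n. even (card {i. bit n i})}"

datatype letter = T | B

fun flip :: "letter \<Rightarrow> letter" where
  "flip T = B"
| "flip B = T"

text \<open>The letter written $X_n$ on paper.\<close>

definition twist :: "letter \<Rightarrow> nat \<Rightarrow> letter" where
  "twist X n = (if n \<in> evil then X else flip X)"

text \<open>Throughout, the parameters are meant to satisfy \<open>m = k * 2 ^ z\<close> with \<open>k\<close> odd,
  \<open>p > 0\<close> and \<open>r < m\<close>. The library function \<open>floorlog b x\<close> is the number of base-\<open>b\<close> digits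
  of \<open>x\<close> without leading zeroes, with value \<open>0\<close> for \<open>x = 0\<close>.\<close>

definition Nmax :: "nat \<Rightarrow> nat \<Rightarrow> nat \<Rightarrow> nat" where
  "Nmax z p r = max (nat \<lceil>real z / real p\<rceil>) (floorlog (2 ^ p) r)"

text \<open>The division \<open>m div 2 ^ (p * \<alpha>)\<close> is exact in the branch where it occurs. The two branches
  agree when \<open>\<alpha> = z / p\<close>.\<close>

definition C' :: "nat \<Rightarrow> nat \<Rightarrow> nat \<Rightarrow> nat \<Rightarrow> nat \<Rightarrow> nat \<Rightarrow> (nat \<times> letter) set" where
  "C' m k z p r \<alpha> =
    (if real \<alpha> \<le> real z / real p
     then {(r div 2 ^ (p * \<alpha>) + l * (m div 2 ^ (p * \<alpha>)), twist T l) | l. l \<in> {0..2 ^ (p * \<alpha>) - 1}}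
     else {(r div 2 ^ (p * \<alpha>) + l * k, twist T l) | l. l \<in> {0..2 ^ z - 1}})"

definition C :: "nat \<Rightarrow> nat \<Rightarrow> nat \<Rightarrow> nat \<Rightarrow> nat \<Rightarrow> nat \<Rightarrow> (nat \<times> letter) set" where
  "C m k z p r \<alpha> = C' m k z p r \<alpha> - (\<Union>\<beta>\<in>{..<\<alpha>}. C' m k z p r \<beta>)"

definition D' :: "nat \<Rightarrow> nat \<Rightarrow> nat \<times> letter \<Rightarrow> (nat \<times> letter) set" where
  "D' k z = (\<lambda>(j, X). {(j + l * k, twist X l) | l. l \<in> {0..2 ^ z - 1}})"

definition D :: "nat \<Rightarrow> nat \<Rightarrow> nat \<Rightarrow> nat \<Rightarrow> nat \<Rightarrow> nat \<times> letter \<Rightarrow> (nat \<times> letter) set" where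
  "D m k z p r jX = D' k z jX - (\<Union>\<alpha>\<in>{0..Nmax z p r}. C m k z p r \<alpha>)"

end

theory Submission
  imports Defs
begin

text \<open>For \<open>r = 0\<close> the sets \<open>C'\<close> form an increasing chain: \<open>C'\<close> at \<open>\<alpha>\<close> is \<open>grid k z s\<close> with
  \<open>s = min (p * \<alpha>) z\<close>. Passing from \<open>s\<close> to \<open>s + 1\<close> halves the mesh; even indices give back the old
  points with the old letters since \<open>2 * l\<close> and \<open>l\<close> have the same digit sum, and odd indices give a
  new layer, whose letters are flipped since \<open>2 * l + 1\<close> has one more digit \<open>1\<close>.\<close>

definition grid :: "nat \<Rightarrow> nat \<Rightarrow> nat \<Rightarrow> (nat \<times> letter) set" where
  "grid k z s = (\<lambda>l. (l * (k * 2 ^ (z - s)), twist T l)) ` {..<2 ^ s}"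

text \<open>For \<open>s < z\<close> the first coordinates are the odd multiples
  \<open>(2 * l + 1) * (k * 2 ^ (z - s - 1))\<close> of the next mesh. The shape matches the sets in
  the theorem so that they can be folded.\<close>

definition layer :: "nat \<Rightarrow> nat \<Rightarrow> nat \<Rightarrow> (nat \<times> letter) set" where
  "layer k z s =
    {(k * 2 ^ (z - s - 1) + l * k * 2 ^ (z - s), twist B l) | l. l \<in> {0..2 ^ s - 1}}"

lemma atLeastAtMost_pow2_minus_1: "{0..2 ^ s - 1} = {..<2 ^ s :: nat}"
proof -
  have "Suc (2 ^ s - 1) = (2 ^ s :: nat)" by simp
  then show ?thesis
    by (metis atLeast0AtMost lessThan_Suc_atMost)
qed

text \<open>Needed so that inserting one new digit position raises the cardinality by exactly
  one.\<close>

lemma finite_bits_nat: "finite {i. bit (n :: nat) i}"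
proof (rule finite_subset)
  show "{i. bit n i} \<subseteq> {..<n}"
  proof
    fix i assume "i \<in> {i. bit n i}"
    then have "2 ^ i \<le> n"
      by (metis bit_iff_odd div_less even_zero mem_Collect_eq not_le)
    then show "i \<in> {..<n}"
      using less_le_trans[OF less_exp] by blast
  qed
qed simp

lemma bits_double: "{i. bit (2 * n :: nat) i} = Suc ` {i. bit n i}"
proof -
  have "bit (2 * n) i \<longleftrightarrow> i \<in> Suc ` {i. bit n i}" for i
    by (cases i) (auto simp: bit_0 bit_Suc)
  then show ?thesis by blast
qed

lemma bits_Suc_double: "{i. bit (Suc (2 * n)) i} = insert 0 (Suc ` {i. bit n i})"
proof -
  have "bit (Suc (2 * n)) i \<longleftrightarrow> i \<in> insert 0 (Suc ` {i. bit n i})" for i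
    by (cases i) (auto simp: bit_0 bit_Suc)
  then show ?thesis by blast
qed

lemma evil_double [simp]: "2 * n \<in> evil \<longleftrightarrow> n \<in> evil"
  by (simp add: evil_def bits_double card_image)

lemma evil_Suc_double [simp]: "Suc (2 * n) \<in> evil \<longleftrightarrow> n \<notin> evil"
  by (simp add: evil_def bits_Suc_double card_image finite_bits_nat)

lemma zero_evil: "0 \<in> evil"
  by (simp add: evil_def bot_fun_def)

lemma twist_double: "twist X (2 * l) = twist X l"
  by (simp add: twist_def)

lemma twist_Suc_double: "twist X (Suc (2 * l)) = twist (flip X) l"
  by (cases X) (simp_all add: twist_def)

lemma twist_eq_iff: "twist X l = twist Y l \<longleftrightarrow> X = Y"
  by (cases X; cases Y) (simp_all add: twist_def)

lemma lessThan_double: "{..<2 * n :: nat} = (*) 2 ` {..<n} \<union> (\<lambda>l. Suc (2 * l)) ` {..<n}"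
proof (intro equalityI subsetI)
  fix x assume "x \<in> {..<2 * n}"
  then show "x \<in> (*) 2 ` {..<n} \<union> (\<lambda>l. Suc (2 * l)) ` {..<n}"
    by (cases "even x") (force elim: evenE oddE)+
qed auto

lemma grid_Suc:
  assumes "s < z"
  shows "grid k z (Suc s) = grid k z s \<union> layer k z s"
proof -
  \<comment> \<open>By \<open>s < z\<close> the exponent is not truncated, so the mesh really
    halves.\<close>
  have pow: "2 ^ (z - s) = 2 * (2 :: nat) ^ (z - Suc s)"
    using assms by (metis Suc_diff_Suc power_Suc)
  have "grid k z (Suc s) =
      (\<lambda>l. (2 * l * (k * 2 ^ (z - Suc s)), twist T (2 * l))) ` {..<2 ^ s} \<union>
      (\<lambda>l. (Suc (2 * l) * (k * 2 ^ (z - Suc s)), twist T (Suc (2 * l)))) ` {..<2 ^ s}"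
    unfolding grid_def power_Suc lessThan_double image_Un image_image ..
  also have "\<dots> = grid k z s \<union> layer k z s"
    unfolding grid_def layer_def atLeastAtMost_pow2_minus_1 Setcompr_eq_image pow twist_double
      twist_Suc_double flip.simps
    by (simp add: algebra_simps)
  finally show ?thesis .
qed

text \<open>First coordinates already differ: in units of \<open>k * 2 ^ (z - Suc s)\<close>, which
  is nonzero, they are even on the grid and odd on the layer.\<close>

lemma grid_layer_disjoint:
  assumes "s < z" and "k > 0"
  shows "grid k z s \<inter> layer k z s = {}"
proof -
  have pow: "2 ^ (z - s) = 2 * (2 :: nat) ^ (z - Suc s)"
    using assms by (metis Suc_diff_Suc power_Suc)
  have "l * (k * 2 ^ (z - s)) \<noteq> k * 2 ^ (z - s - 1) + l' * k * 2 ^ (z - s)" for l l'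
  proof
    assume "l * (k * 2 ^ (z - s)) = k * 2 ^ (z - s - 1) + l' * k * 2 ^ (z - s)"
    then have "(2 * l) * (k * 2 ^ (z - Suc s)) = Suc (2 * l') * (k * 2 ^ (z - Suc s))"
      by (simp add: pow algebra_simps)
    then have "2 * l = Suc (2 * l')"
      using assms by (simp only: mult_cancel2) simp
    then show False by presburger
  qed
  then show ?thesis
    by (auto simp: grid_def layer_def)
qed

lemma grid_mono:
  assumes "s \<le> t" and "t \<le> z"
  shows "grid k z s \<subseteq> grid k z t"
  using assms by (induction rule: dec_induct) (auto simp: grid_Suc)

text \<open>Iterates \<open>grid_Suc\<close>. Each added layer survives the subtraction because it
  misses the current grid, which contains \<open>grid k z s\<close>.\<close>

lemma grid_diff:
  assumes "s \<le> t" and "t \<le> z" and "k > 0"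
  shows "grid k z t - grid k z s = (\<Union>\<beta>\<in>{s..<t}. layer k z \<beta>)"
  using assms(1,2)
proof (induction rule: dec_induct)
  case (step n)
  have "grid k z n \<inter> layer k z n = {}"
    using step.prems assms(3) by (intro grid_layer_disjoint) auto
  moreover have "grid k z s \<subseteq> grid k z n"
    using step by (intro grid_mono) auto
  ultimately have "grid k z (Suc n) - grid k z s = (grid k z n - grid k z s) \<union> layer k z n"
    using step.prems by (auto simp: grid_Suc)
  with step show ?case
    by (auto simp: atLeastLessThanSuc)
qed simp

text \<open>The offset vanishes, and the second branch (mesh \<open>k\<close>, \<open>2 ^ z\<close>
  points) is the case \<open>s = z\<close>; the minimum merges both branches.\<close>

lemma C'_zero_eq_grid:
  assumes "p > 0"
  shows "C' (k * 2 ^ z) k z p 0 \<alpha> = grid k z (min (p * \<alpha>) z)"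
proof -
  have "real \<alpha> \<le> real z / real p \<longleftrightarrow> p * \<alpha> \<le> z"
    using assms by (simp add: pos_le_divide_eq mult.commute flip: of_nat_mult)
  moreover have "k * 2 ^ z div 2 ^ (p * \<alpha>) = k * 2 ^ (z - p * \<alpha>)" if "p * \<alpha> \<le> z"
    using that by (simp add: power_diff div_mult_swap le_imp_power_dvd)
  ultimately show ?thesis
    unfolding C'_def atLeastAtMost_pow2_minus_1 Setcompr_eq_image by (simp add: grid_def min_def)
qed

text \<open>The finest grid tops the chain, so the sets \<open>D'\<close> need comparing with this
  single set only.\<close>

lemma C_zero_subset_grid:
  assumes "p > 0"
  shows "C (k * 2 ^ z) k z p 0 \<alpha> \<subseteq> grid k z z"
  using grid_mono[of "min (p * \<alpha>) z" z z k]
  by (auto simp: C_def C'_zero_eq_grid[OF assms])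

lemma C_zero_Suc:
  assumes "p > 0" and "k > 0"
  shows "C (k * 2 ^ z) k z p 0 (Suc \<alpha>) =
    (\<Union>\<beta>\<in>{min (p * \<alpha>) z..<min (p * Suc \<alpha>) z}. layer k z \<beta>)"
proof -
  \<comment> \<open>In an increasing chain the union of all earlier sets is the last of them,
    leaving a difference of two grids.\<close>
  have "(\<Union>\<beta>\<in>{..<Suc \<alpha>}. grid k z (min (p * \<beta>) z)) = grid k z (min (p * \<alpha>) z)"
  proof (intro equalityI UN_least)
    fix \<beta> assume "\<beta> \<in> {..<Suc \<alpha>}"
    then have "p * \<beta> \<le> p * \<alpha>" by simp
    then show "grid k z (min (p * \<beta>) z) \<subseteq> grid k z (min (p * \<alpha>) z)"
      by (intro grid_mono min.mono) simp_all
  qed auto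
  moreover have "min (p * \<alpha>) z \<le> min (p * Suc \<alpha>) z" by auto
  ultimately show ?thesis
    unfolding C_def C'_zero_eq_grid[OF assms(1)] using assms(2) by (simp only: grid_diff)
qed

text \<open>Division by \<open>k\<close> recovers \<open>j\<close> as remainder and \<open>l\<close>
  as quotient. A common point thus has \<open>j = 0\<close> and equal indices, and equal letters
  then force the excluded \<open>X = T\<close>.\<close>

lemma D'_grid_disjoint:
  assumes "j < k" and "(j, X) \<noteq> (0, T)"
  shows "D' k z (j, X) \<inter> grid k z z = {}"
proof -
  have neq: False if eq: "l' * k = j + l * k" and tw: "twist T l' = twist X l" for l l'
  proof -
    from eq[symmetric] have "(j + l * k) mod k = 0" "(j + l * k) div k = l'"
      using assms(1) by simp_all
    then have "j = 0" "l = l'"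
      using assms(1) by simp_all
    with tw assms(2) show False
      by (simp add: twist_eq_iff)
  qed
  then show ?thesis
    by (auto simp: D'_def grid_def dest: neq)
qed

theorem corollary49:
  fixes m p k z r N :: nat
  assumes "m > 0" and "p > 0"
    and "m = k * 2 ^ z" and "odd k"
    and "r = 0"
    and "N = Nmax z p r"
  shows "N = nat \<lceil>real z / real p\<rceil>
    \<and> C m k z p r 0 = {(0, T)}
    \<and> (\<forall>\<alpha>. 1 \<le> \<alpha> \<and> \<alpha> \<le> N - 1 \<longrightarrow>
         C m k z p r \<alpha> =
           (\<Union>\<beta>\<in>{(\<alpha> - 1) * p..\<alpha> * p - 1}.
              {(k * 2 ^ (z - \<beta> - 1) + l * k * 2 ^ (z - \<beta>), twist B l) | l. l \<in> {0..2 ^ \<beta> - 1}}))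
    \<and> (1 \<le> N \<longrightarrow>
         C m k z p r N =
           (\<Union>\<beta>\<in>{(nat \<lceil>real z / real p\<rceil> - 1) * p..z - 1}.
              {(k * 2 ^ (z - \<beta> - 1) + l * k * 2 ^ (z - \<beta>), twist B l) | l. l \<in> {0..2 ^ \<beta> - 1}}))
    \<and> (\<forall>(j, X) \<in> ({0..k - 1} \<times> {T, B}) - {(0, T)}.
         D m k z p r (j, X) = {(j + l * k, twist X l) | l. l \<in> {0..2 ^ z - 1}})"
proof -
  have k: "k > 0"
    using assms(4) by (cases k) auto
  have m: "C m k z p r = C (k * 2 ^ z) k z p 0"
    using assms by simp
  \<comment> \<open>\<open>floorlog\<close> is \<open>0\<close> at \<open>0\<close>, so the maximum
    is its first argument.\<close>
  have N: "N = nat \<lceil>real z / real p\<rceil>"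
    using assms by (simp add: Nmax_def floorlog_def)
  \<comment> \<open>This turns the ceiling into integer inequalities that decide which minima are
    cut off at \<open>z\<close>.\<close>
  have le_N: "N \<le> \<alpha> \<longleftrightarrow> z \<le> p * \<alpha>" for \<alpha>
  proof -
    have "N \<le> \<alpha> \<longleftrightarrow> real z / real p \<le> real \<alpha>"
      unfolding N by (simp add: ceiling_le_iff)
    also have "\<dots> \<longleftrightarrow> z \<le> p * \<alpha>"
      using assms(2) by (simp add: pos_divide_le_eq mult.commute flip: of_nat_mult)
    finally show ?thesis .
  qed
  \<comment> \<open>Nothing is subtracted, and the coarsest grid has only the index
    \<open>0\<close>, whose digit sum is even.\<close>
  have C_0: "C m k z p r 0 = {(0, T)}"
    unfolding m by (simp add: C_def C'_zero_eq_grid[OF assms(2)] grid_def lessThan_Suc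
        twist_def zero_evil)
  have C_mid: "C m k z p r \<alpha> = (\<Union>\<beta>\<in>{(\<alpha> - 1) * p..\<alpha> * p - 1}. layer k z \<beta>)"
    if \<alpha>: "1 \<le> \<alpha>" "\<alpha> \<le> N - 1" for \<alpha>
  proof -
    obtain a where a: "\<alpha> = Suc a"
      using \<alpha> by (cases \<alpha>) auto
    have "p * \<alpha> < z"
      using le_N[of \<alpha>] \<alpha> by linarith
    \<comment> \<open>Both minima lie below the cutoff; as \<open>\<alpha> * p > 0\<close>, the
      closed upper bound is not truncated.\<close>
    then have "{min (p * a) z..<min (p * Suc a) z} = {(\<alpha> - 1) * p..\<alpha> * p - 1}"
      using assms(2) by (auto simp: a mult.commute)
    then show ?thesis
      unfolding m a by (simp only: C_zero_Suc[OF assms(2) k])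
  qed
  have C_N: "C m k z p r N = (\<Union>\<beta>\<in>{(N - 1) * p..z - 1}. layer k z \<beta>)" if "1 \<le> N"
  proof -
    from that obtain a where a: "N = Suc a"
      by (cases N) auto
    \<comment> \<open>Only the upper minimum is cut off, at \<open>z\<close>; the first inequality
      also gives \<open>z > 0\<close>, so \<open>z - 1\<close> is a true predecessor.\<close>
    have "p * a < z" "z \<le> p * Suc a"
      using le_N[of a] le_N[of N] a by auto
    then have "{min (p * a) z..<min (p * Suc a) z} = {(N - 1) * p..z - 1}"
      by (auto simp: a mult.commute)
    then show ?thesis
      unfolding m using a by (simp only: C_zero_Suc[OF assms(2) k])
  qed
  have D_eq: "D m k z p r (j, X) = {(j + l * k, twist X l) | l. l \<in> {0..2 ^ z - 1}}"
    if "j \<in> {0..k - 1}" "(j, X) \<noteq> (0, T)" for j X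
  proof -
    have "j < k"
      using that(1) k by auto
    then have "D m k z p r (j, X) = D' k z (j, X)"
      using D'_grid_disjoint[OF _ that(2), of k z] C_zero_subset_grid[OF assms(2), of k z]
      unfolding D_def m by blast
    then show ?thesis
      by (simp add: D'_def)
  qed
  show ?thesis
    \<comment> \<open>Folding the ceiling into \<open>N\<close> makes the first conjunct
      reflexive.\<close>
    unfolding N[symmetric] layer_def[symmetric]
  proof (intro conjI refl C_0 C_N allI impI)
    show "C m k z p r \<alpha> = (\<Union>\<beta>\<in>{(\<alpha> - 1) * p..\<alpha> * p - 1}. layer k z \<beta>)"
      if "1 \<le> \<alpha> \<and> \<alpha> \<le> N - 1" for \<alpha>
      using that by (intro C_mid) simp_all
    show "\<forall>(j, X) \<in> ({0..k - 1} \<times> {T, B}) - {(0, T)}.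
        D m k z p r (j, X) = {(j + l * k, twist X l) | l. l \<in> {0..2 ^ z - 1}}"
    proof
      fix x assume x: "x \<in> ({0..k - 1} \<times> {T, B}) - {(0, T)}"
      obtain j X where "x = (j, X)" by (cases x)
      with x show "case x of (j, X) \<Rightarrow>
          D m k z p r (j, X) = {(j + l * k, twist X l) | l. l \<in> {0..2 ^ z - 1}}"
        by (simp only: prod.case, intro D_eq) simp_all
    qed
  qed
qed

end
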